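(* Let $m\ge0$ and let $\phi$ be a real scalar field on Minkowski spacetime satisfying $(\Box+m^2)\phi=0$. The 1-superenergy $W_{(1)}[\phi]$ and the spatial 1-supermomentum $S^i_{(1)}[\phi]$ ($i=1,2,3$) are related to the weak 1-superenergy $U_{(1)}[\phi]$ and the weak spatial 1-supermomentum $R^i_{(1)}[\phi]$ (all defined in the context) by $$W_{(1)}[\phi]=U_{(1)}[\phi]+[\mathrm{Surf}],\qquad S^i_{(1)}[\phi]=R^i_{(1)}[\phi]+[\mathrm{Surf}],$$ where $[\mathrm{Surf}]$ denotes surface terms, i.e. integrals over the 3-space $x^0=\text{const.}$ of a spatial divergence $\partial_jV^j$ with $V^j$ quadratic in $\phi$ and its partial derivatives (so the corresponding integrands differ by such a divergence). These surface terms vanish if $\phi$ and $\phi_{,0}$ are functions of rapid decrease at spatial infinity, so that in this case $W_{(1)}[\phi]=U_{(1)}[\phi]$ and $S^i_{(1)}[\phi]=R^i_{(1)}[\phi]$.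
   Context: Setting: Minkowski spacetime $\mathbb{R}^4$ with Galilean coordinates $x^\alpha=(x^0,\mathbf{x})$ and metric $g_{\alpha\beta}=\mathrm{diag}(1,-1,-1,-1)$, used to raise and lower indices; commas denote partial derivatives; $\Box=g^{\alpha\beta}\partial_\alpha\partial_\beta$. Latin indices run over $1,2,3$. Round brackets denote symmetrization with weight one: $X^{(\alpha\beta)}=\frac12(X^{\alpha\beta}+X^{\beta\alpha})$. "Rapid decrease at spatial infinity" means being a Schwartz function of $\mathbf{x}$ on the slice $x^0=\text{const.}$ Define $$\tau^{\alpha\beta}=\phi^{,\alpha\lambda}{\phi^{,\beta}}_{\lambda}-m^2\phi^{,\alpha}\phi^{,\beta}-\tfrac12 K g^{\alpha\beta},\qquad K=\tfrac12\phi^{,\rho\sigma}\phi_{,\rho\sigma}-m^2\phi^{,\lambda}\phi_{,\lambda}+\tfrac12 m^4\phi^2,$$ $$W^{\alpha\beta\gamma\delta}=\tfrac13\left(\phi^{,\alpha\beta}\phi^{,\gamma\delta}+2\phi^{,\alpha(\gamma}\phi^{,\delta)\beta}\right)-\tfrac16\left(g^{\alpha\beta}\tau^{\gamma\delta}+g^{\gamma\delta}\tau^{\alpha\beta}+2g^{\alpha(\gamma}\tau^{\delta)\beta}+2g^{\beta(\gamma}\tau^{\delta)\alpha}\right).$$ The 1-superenergy and spatial 1-supermomentum are $$W_{(1)}[\phi]=\int W^{0000}(x^0,\mathbf{x})\,d^3\mathbf{x},\qquad S^i_{(1)}[\phi]=\int W^{i000}(x^0,\mathbf{x})\,d^3\mathbf{x}.$$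 The weak 1-superenergy tensor is $$U^{\alpha\beta\mu\nu}=\tfrac12\left(\phi^{,\alpha\mu}\phi^{,\beta\nu}+\phi^{,\beta\mu}\phi^{,\alpha\nu}\right)-\tfrac12g^{\alpha\beta}\left(\phi^{,\lambda\mu}{\phi^{,\nu}}_{\lambda}-m^2\phi^{,\mu}\phi^{,\nu}\right),$$ and the weak 1-superenergy and weak spatial 1-supermomentum are $$U_{(1)}[\phi]=\int U^{0000}\,d^3\mathbf{x}=\tfrac12\int\Big[(\phi_{,00})^2+\sum_i(\phi_{,i0})^2+m^2(\phi_{,0})^2\Big]d^3\mathbf{x},\qquad R^i_{(1)}[\phi]=\int U^{i000}\,d^3\mathbf{x}=-\int\phi_{,00}\,\phi_{,i0}\,d^3\mathbf{x}.$$ *)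

theory Defs
  imports "HOL-Analysis.Analysis"
begin

section \<open>Iterated partial derivatives, smoothness, rapid decrease\<close>

definition partial_deriv :: "'n::finite \<Rightarrow> (real^'n \<Rightarrow> real) \<Rightarrow> real^'n \<Rightarrow> real" where
  "partial_deriv i f x = deriv (\<lambda>s. f (x + s *\<^sub>R axis i 1)) 0"

text \<open>The list gives the differentiations in the order of the indices after the comma:
  \<open>partials [\<alpha>, \<beta>] \<phi>\<close> is \<open>\<phi>\<^sub>,\<^sub>\<alpha>\<^sub>\<beta>\<close>, i.e. first \<open>\<partial>\<^sub>\<alpha>\<close>, then \<open>\<partial>\<^sub>\<beta>\<close>.\<close>

definition partials :: "'n::finite list \<Rightarrow> (real^'n \<Rightarrow> real) \<Rightarrow> real^'n \<Rightarrow> real" where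
  "partials is f = fold partial_deriv is f"

text \<open>This is \<open>C\<^sup>\<infinity>\<close>: a differentiable function is continuous and has all its first partial
  derivatives, so all iterated partial derivatives exist and are continuous, and conversely
  continuity of all iterated partial derivatives gives differentiability of each of them.\<close>

definition smooth :: "(real^'n::finite \<Rightarrow> real) \<Rightarrow> bool" where
  "smooth f \<longleftrightarrow> (\<forall>is. partials is f differentiable_on UNIV)"

definition rapidly_decreasing :: "(real^'n::finite \<Rightarrow> real) \<Rightarrow> bool" where
  "rapidly_decreasing f \<longleftrightarrow>
     smooth f \<and> (\<forall>(k::nat) is. \<exists>C. \<forall>x. norm x ^ k * \<bar>partials is f x\<bar> \<le> C)"

section \<open>Minkowski spacetime\<close>

text \<open>In the index type \<open>4\<close> arithmetic is modulo 4, so its elements are 0, 1, 2, 3 (with 4 = 0);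
  0 is the time index and the Latin indices range over \<open>{1, 2, 3}\<close>. Likewise \<open>3 = 0\<close> in the
  index type \<open>3\<close> of the spatial slices.\<close>

type_synonym scalar_field = "real^4 \<Rightarrow> real"

definition event :: "real \<Rightarrow> real^3 \<Rightarrow> real^4" where
  "event t x = (\<chi> \<mu>. if \<mu> = 0 then t else if \<mu> = 1 then x $ 1 else if \<mu> = 2 then x $ 2 else x $ 3)"

text \<open>The matrix diag(1, -1, -1, -1), which gives both the components \<open>g\<^sub>\<alpha>\<^sub>\<beta>\<close> and \<open>g\<^sup>\<alpha>\<^sup>\<beta>\<close>.\<close>

definition eta :: "4 \<Rightarrow> 4 \<Rightarrow> real" where
  "eta \<alpha> \<beta> = (if \<alpha> = \<beta> then (if \<alpha> = 0 then 1 else - 1) else 0)"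

definition dalembertian :: "scalar_field \<Rightarrow> scalar_field" where
  "dalembertian \<phi> x = (\<Sum>\<alpha>\<in>UNIV. \<Sum>\<beta>\<in>UNIV. eta \<alpha> \<beta> * partials [\<alpha>, \<beta>] \<phi> x)"

definition klein_gordon :: "real \<Rightarrow> scalar_field \<Rightarrow> bool" where
  "klein_gordon m \<phi> \<longleftrightarrow> (\<forall>x. dalembertian \<phi> x + m\<^sup>2 * \<phi> x = 0)"

text \<open>\<open>\<phi>\<^sup>,\<^sup>\<alpha>\<close>, \<open>\<phi>\<^sup>,\<^sup>\<alpha>\<^sup>\<beta>\<close> and \<open>\<phi>\<^sup>,\<^sup>\<alpha>\<^sub>\<beta>\<close>:\<close>

definition d_up :: "scalar_field \<Rightarrow> 4 \<Rightarrow> scalar_field" where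
  "d_up \<phi> \<alpha> x = (\<Sum>\<mu>\<in>UNIV. eta \<alpha> \<mu> * partials [\<mu>] \<phi> x)"

definition dd_up :: "scalar_field \<Rightarrow> 4 \<Rightarrow> 4 \<Rightarrow> scalar_field" where
  "dd_up \<phi> \<alpha> \<beta> x = (\<Sum>\<mu>\<in>UNIV. \<Sum>\<nu>\<in>UNIV. eta \<alpha> \<mu> * eta \<beta> \<nu> * partials [\<mu>, \<nu>] \<phi> x)"

definition dd_mixed :: "scalar_field \<Rightarrow> 4 \<Rightarrow> 4 \<Rightarrow> scalar_field" where
  "dd_mixed \<phi> \<alpha> \<beta> x = (\<Sum>\<mu>\<in>UNIV. eta \<alpha> \<mu> * partials [\<mu>, \<beta>] \<phi> x)"

text \<open>\<open>X\<^sup>(\<^sup>\<alpha>\<^sup>\<beta>\<^sup>)\<close>:\<close>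

definition symm :: "(4 \<Rightarrow> 4 \<Rightarrow> real) \<Rightarrow> 4 \<Rightarrow> 4 \<Rightarrow> real" where
  "symm X \<alpha> \<beta> = (X \<alpha> \<beta> + X \<beta> \<alpha>) / 2"

section \<open>The 1-superenergy tensor and the weak 1-superenergy tensor\<close>

definition invariant_K :: "real \<Rightarrow> scalar_field \<Rightarrow> scalar_field" where
  "invariant_K m \<phi> x =
     1/2 * (\<Sum>\<rho>\<in>UNIV. \<Sum>\<sigma>\<in>UNIV. dd_up \<phi> \<rho> \<sigma> x * partials [\<rho>, \<sigma>] \<phi> x)
     - m\<^sup>2 * (\<Sum>\<kappa>\<in>UNIV. d_up \<phi> \<kappa> x * partials [\<kappa>] \<phi> x)
     + 1/2 * m^4 * (\<phi> x)\<^sup>2"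

definition tau :: "real \<Rightarrow> scalar_field \<Rightarrow> 4 \<Rightarrow> 4 \<Rightarrow> scalar_field" where
  "tau m \<phi> \<alpha> \<beta> x =
     (\<Sum>\<kappa>\<in>UNIV. dd_up \<phi> \<alpha> \<kappa> x * dd_mixed \<phi> \<beta> \<kappa> x)
     - m\<^sup>2 * d_up \<phi> \<alpha> x * d_up \<phi> \<beta> x
     - 1/2 * invariant_K m \<phi> x * eta \<alpha> \<beta>"

definition superenergy_tensor :: "real \<Rightarrow> scalar_field \<Rightarrow> 4 \<Rightarrow> 4 \<Rightarrow> 4 \<Rightarrow> 4 \<Rightarrow> scalar_field" where
  "superenergy_tensor m \<phi> \<alpha> \<beta> \<gamma> \<delta> x =
     1/3 * (dd_up \<phi> \<alpha> \<beta> x * dd_up \<phi> \<gamma> \<delta> x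
            + 2 * symm (\<lambda>\<gamma> \<delta>. dd_up \<phi> \<alpha> \<gamma> x * dd_up \<phi> \<delta> \<beta> x) \<gamma> \<delta>)
     - 1/6 * (eta \<alpha> \<beta> * tau m \<phi> \<gamma> \<delta> x + eta \<gamma> \<delta> * tau m \<phi> \<alpha> \<beta> x
              + 2 * symm (\<lambda>\<gamma> \<delta>. eta \<alpha> \<gamma> * tau m \<phi> \<delta> \<beta> x) \<gamma> \<delta>
              + 2 * symm (\<lambda>\<gamma> \<delta>. eta \<beta> \<gamma> * tau m \<phi> \<delta> \<alpha> x) \<gamma> \<delta>)"

definition weak_superenergy_tensor :: "real \<Rightarrow> scalar_field \<Rightarrow> 4 \<Rightarrow> 4 \<Rightarrow> 4 \<Rightarrow> 4 \<Rightarrow> scalar_field" where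
  "weak_superenergy_tensor m \<phi> \<alpha> \<beta> \<mu> \<nu> x =
     1/2 * (dd_up \<phi> \<alpha> \<mu> x * dd_up \<phi> \<beta> \<nu> x + dd_up \<phi> \<beta> \<mu> x * dd_up \<phi> \<alpha> \<nu> x)
     - 1/2 * eta \<alpha> \<beta> * ((\<Sum>\<kappa>\<in>UNIV. dd_up \<phi> \<kappa> \<mu> x * dd_mixed \<phi> \<nu> \<kappa> x)
                        - m\<^sup>2 * d_up \<phi> \<mu> x * d_up \<phi> \<nu> x)"

section \<open>Integrals over the slices of constant time\<close>

definition slice_integrable :: "scalar_field \<Rightarrow> real \<Rightarrow> bool" where
  "slice_integrable F t \<longleftrightarrow> integrable lborel (\<lambda>x. F (event t x))"

definition slice_integral :: "scalar_field \<Rightarrow> real \<Rightarrow> real" where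
  "slice_integral F t = (LINT x|lborel. F (event t x))"

definition superenergy :: "real \<Rightarrow> scalar_field \<Rightarrow> real \<Rightarrow> real" where
  "superenergy m \<phi> = slice_integral (superenergy_tensor m \<phi> 0 0 0 0)"

definition supermomentum :: "real \<Rightarrow> scalar_field \<Rightarrow> 4 \<Rightarrow> real \<Rightarrow> real" where
  "supermomentum m \<phi> i = slice_integral (superenergy_tensor m \<phi> i 0 0 0)"

definition weak_superenergy :: "real \<Rightarrow> scalar_field \<Rightarrow> real \<Rightarrow> real" where
  "weak_superenergy m \<phi> = slice_integral (weak_superenergy_tensor m \<phi> 0 0 0 0)"

definition weak_supermomentum :: "real \<Rightarrow> scalar_field \<Rightarrow> 4 \<Rightarrow> real \<Rightarrow> real" where
  "weak_supermomentum m \<phi> i = slice_integral (weak_superenergy_tensor m \<phi> i 0 0 0)"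

section \<open>Surface terms\<close>

text \<open>A homogeneous quadratic expression in a field and its partial derivatives of any order, with
  constant coefficients. It is an operator acting on all fields, so the coefficients cannot
  depend on the field to which it is applied.\<close>

definition quadratic_expression :: "(scalar_field \<Rightarrow> scalar_field) \<Rightarrow> bool" where
  "quadratic_expression F \<longleftrightarrow>
     (\<exists>terms :: (real \<times> 4 list \<times> 4 list) list. \<forall>\<phi> x.
        F \<phi> x = (\<Sum>(c, p, q)\<leftarrow>terms. c * partials p \<phi> x * partials q \<phi> x))"

definition spatial_divergence :: "(4 \<Rightarrow> scalar_field) \<Rightarrow> scalar_field" where
  "spatial_divergence V x = (\<Sum>j\<in>{1, 2, 3}. partial_deriv j (V j) x)"

definition surface_term :: "(4 \<Rightarrow> scalar_field \<Rightarrow> scalar_field) \<Rightarrow> scalar_field \<Rightarrow> real \<Rightarrow> real" where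
  "surface_term V \<phi> = slice_integral (spatial_divergence (\<lambda>j. V j \<phi>))"

end

theory Submission
  imports Defs "HOL-Probability.Sinc_Integral"
begin

text \<open>Eliminating \<open>\<phi>\<^sub>,\<^sub>0\<^sub>0\<close> by the field equation turns the difference of the two densities into a
  polynomial in \<open>\<phi>\<close>, \<open>\<phi>\<^sub>,\<^sub>0\<close> and their spatial derivatives, which is an explicit spatial divergence.
  If \<open>\<phi>\<close> and \<open>\<phi>\<^sub>,\<^sub>0\<close> are of rapid decrease on a slice, then so are all these derivatives, and by the
  field equation \<open>\<phi>\<^sub>,\<^sub>0\<^sub>0\<close> as well, so all densities are integrable there. A divergence of products of such functions
  integrates to 0: the integral of a difference quotient vanishes by translation invariance of Lebesgue measure,
  and one passes to the limit by dominated convergence.\<close>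

section \<open>Partial derivatives of smooth functions\<close>

lemma partials_simps [simp]:
  "partials [] f = f"
  "partials (k # ks) f = partials ks (partial_deriv k f)"
  by (simp_all add: partials_def)

lemma smooth_partial_deriv:
  assumes "smooth f"
  shows "smooth (partial_deriv i f)"
  unfolding smooth_def
proof
  fix ks
  show "partials ks (partial_deriv i f) differentiable_on UNIV"
    using assms unfolding smooth_def by (metis partials_simps(2))
qed

lemma smooth_differentiable:
  assumes "smooth f"
  shows "f differentiable (at x)"
proof -
  have "partials [] f differentiable_on UNIV"
    using assms unfolding smooth_def by blast
  then show ?thesis
    by (simp add: differentiable_on_eq_differentiable_at)
qed

lemma smooth_isCont: "smooth f \<Longrightarrow> isCont f x"
  by (simp add: differentiable_imp_continuous_within smooth_differentiable)

text \<open>\<open>partial_deriv\<close> is a value of \<open>deriv\<close> and does not by itself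
  assert differentiability; that comes from the chain rule along the line. Shifting the parameter
  moves the base point, so the derivative is available at every \<open>s\<close>, as the mean value
  theorem requires.\<close>

lemma smooth_has_partial_deriv:
  assumes "smooth f"
  shows "((\<lambda>s. f (x + s *\<^sub>R axis i 1)) has_real_derivative
           partial_deriv i f (x + s *\<^sub>R axis i 1)) (at s)"
proof -
  let ?e = "axis i (1 :: real)"
  have "(f \<circ> (\<lambda>r. x + s *\<^sub>R ?e + r *\<^sub>R ?e)) differentiable (at 0)"
    by (rule differentiable_chain_at) (auto simp: smooth_differentiable[OF assms])
  then have "(\<lambda>r. f (x + s *\<^sub>R ?e + r *\<^sub>R ?e)) differentiable (at 0)"
    by (simp add: o_def)
  then have "((\<lambda>r. f (x + s *\<^sub>R ?e + r *\<^sub>R ?e)) has_real_derivative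
               partial_deriv i f (x + s *\<^sub>R ?e)) (at 0)"
    unfolding partial_deriv_def by (metis DERIV_deriv_iff_real_differentiable)
  then show ?thesis
    using DERIV_at_within_shift[of "\<lambda>r. f (x + r *\<^sub>R ?e)" "partial_deriv i f (x + s *\<^sub>R ?e)" s 0 UNIV]
    by (simp add: algebra_simps)
qed

text \<open>The mean value theorem is used twice: in direction \<open>i\<close> for the difference
  of \<open>f\<close> along two parallel lines, then in direction \<open>j\<close> for the resulting
  increment of \<open>partial_deriv i f\<close>.\<close>

lemma smooth_second_difference:
  assumes "smooth f" "h > 0"
  obtains \<xi> \<eta> where "\<xi> \<in> {0<..<h}" "\<eta> \<in> {0<..<h}"
    "f (x + h *\<^sub>R axis i 1 + h *\<^sub>R axis j 1) - f (x + h *\<^sub>R axis i 1)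
       - f (x + h *\<^sub>R axis j 1) + f x
     = h\<^sup>2 * partial_deriv j (partial_deriv i f) (x + \<xi> *\<^sub>R axis i 1 + \<eta> *\<^sub>R axis j 1)"
proof -
  let ?a = "axis i (1 :: real)" and ?b = "axis j (1 :: real)"
  let ?G = "\<lambda>s. f (x + h *\<^sub>R ?b + s *\<^sub>R ?a) - f (x + s *\<^sub>R ?a)"
  have "\<exists>\<xi>>0. \<xi> < h \<and> ?G h - ?G 0
      = (h - 0) * (partial_deriv i f (x + h *\<^sub>R ?b + \<xi> *\<^sub>R ?a) - partial_deriv i f (x + \<xi> *\<^sub>R ?a))"
    by (intro MVT2 DERIV_diff smooth_has_partial_deriv assms)
  then obtain \<xi> where \<xi>: "0 < \<xi>" "\<xi> < h"
    "?G h - ?G 0 = h * (partial_deriv i f (x + h *\<^sub>R ?b + \<xi> *\<^sub>R ?a) - partial_deriv i f (x + \<xi> *\<^sub>R ?a))"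
    by auto
  let ?H = "\<lambda>r. partial_deriv i f (x + \<xi> *\<^sub>R ?a + r *\<^sub>R ?b)"
  have "\<exists>\<eta>>0. \<eta> < h \<and> ?H h - ?H 0
      = (h - 0) * partial_deriv j (partial_deriv i f) (x + \<xi> *\<^sub>R ?a + \<eta> *\<^sub>R ?b)"
    by (intro MVT2 smooth_has_partial_deriv smooth_partial_deriv assms)
  then obtain \<eta> where \<eta>: "0 < \<eta>" "\<eta> < h"
    "?H h - ?H 0 = h * partial_deriv j (partial_deriv i f) (x + \<xi> *\<^sub>R ?a + \<eta> *\<^sub>R ?b)"
    by auto
  have "?G h - ?G 0 = h * (?H h - ?H 0)"
    using \<xi>(3) by (simp add: add_ac)
  also have "\<dots> = h\<^sup>2 * partial_deriv j (partial_deriv i f) (x + \<xi> *\<^sub>R ?a + \<eta> *\<^sub>R ?b)"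
    using \<eta>(3) by (simp add: power2_eq_square)
  finally show thesis
    using \<xi>(1,2) \<eta>(1,2) by (intro that[of \<xi> \<eta>]) (simp_all add: algebra_simps)
qed

text \<open>The second difference is symmetric in \<open>i\<close> and \<open>j\<close>, so the two
  mixed derivatives agree at suitable intermediate points. These points converge to
  \<open>x\<close>, and both mixed derivatives are continuous.\<close>

lemma smooth_partial_deriv_commute:
  fixes f :: "real^'n::finite \<Rightarrow> real"
  assumes "smooth f"
  shows "partial_deriv i (partial_deriv j f) = partial_deriv j (partial_deriv i f)"
proof
  fix x :: "real^'n"
  define h where "h n = inverse (real (Suc n))" for n
  have h: "h n > 0" for n
    by (simp add: h_def)
  have h0: "h \<longlonglongrightarrow> 0"
    unfolding h_def by (rule LIMSEQ_inverse_real_of_nat)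
  \<comment> \<open>The first index is the one differentiated first and \<open>p\<close> is the
    displacement along it; exchanging the indices describes the same increment in the other
    order.\<close>
  let ?P = "\<lambda>i j n p q. p \<in> {0<..<h n} \<and> q \<in> {0<..<h n} \<and>
    f (x + h n *\<^sub>R axis i 1 + h n *\<^sub>R axis j 1) - f (x + h n *\<^sub>R axis i 1) - f (x + h n *\<^sub>R axis j 1) + f x
     = (h n)\<^sup>2 * partial_deriv j (partial_deriv i f) (x + p *\<^sub>R axis i 1 + q *\<^sub>R axis j 1)"
  have ex: "\<forall>n. \<exists>p q. ?P i j n p q" for i j
    by (meson smooth_second_difference assms h)
  obtain p q where pq: "\<And>n. ?P i j n (p n) (q n)"
    using ex[of i j] by metis
  obtain p' q' where pq': "\<And>n. ?P j i n (p' n) (q' n)"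
    using ex[of j i] by metis
  have small: "r \<longlonglongrightarrow> 0" if "\<And>n. r n \<in> {0<..<h n}" for r
    by (rule tendsto_sandwich[OF _ _ tendsto_const h0])
       (use that in \<open>auto intro!: always_eventually less_imp_le\<close>)
  have lim: "(\<lambda>n. partial_deriv b (partial_deriv a f) (x + r n *\<^sub>R axis a 1 + s n *\<^sub>R axis b 1))
      \<longlonglongrightarrow> partial_deriv b (partial_deriv a f) x"
    if "r \<longlonglongrightarrow> 0" "s \<longlonglongrightarrow> 0" for r s a b
  proof (rule isCont_tendsto_compose[OF smooth_isCont])
    show "smooth (partial_deriv b (partial_deriv a f))"
      by (intro smooth_partial_deriv assms)
    have "(\<lambda>n. x + r n *\<^sub>R axis a 1 + s n *\<^sub>R axis b 1) \<longlonglongrightarrow> x + 0 *\<^sub>R axis a 1 + 0 *\<^sub>R axis b 1"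
      by (intro tendsto_intros that)
    then show "(\<lambda>n. x + r n *\<^sub>R axis a 1 + s n *\<^sub>R axis b 1) \<longlonglongrightarrow> x"
      by simp
  qed
  have "partial_deriv j (partial_deriv i f) (x + p n *\<^sub>R axis i 1 + q n *\<^sub>R axis j 1)
      = partial_deriv i (partial_deriv j f) (x + p' n *\<^sub>R axis j 1 + q' n *\<^sub>R axis i 1)" for n
  proof -
    have "(h n)\<^sup>2 * partial_deriv j (partial_deriv i f) (x + p n *\<^sub>R axis i 1 + q n *\<^sub>R axis j 1)
      = (h n)\<^sup>2 * partial_deriv i (partial_deriv j f) (x + p' n *\<^sub>R axis j 1 + q' n *\<^sub>R axis i 1)"
    proof -
      have eq: "x + h n *\<^sub>R axis j 1 + h n *\<^sub>R axis i 1 = x + h n *\<^sub>R axis i 1 + h n *\<^sub>R axis j 1"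
        by (simp add: add_ac)
      have *: "H = K" if "A - B - C + D = H" "A - C - B + D = K" for A B C D H K :: real
        using that by simp
      show ?thesis
        by (rule *[OF conjunct2[OF conjunct2[OF pq[of n]]]
              conjunct2[OF conjunct2[OF pq'[of n]], unfolded eq]])
    qed
    then show ?thesis
      using h[of n] by simp
  qed
  moreover have "(\<lambda>n. partial_deriv j (partial_deriv i f) (x + p n *\<^sub>R axis i 1 + q n *\<^sub>R axis j 1))
      \<longlonglongrightarrow> partial_deriv j (partial_deriv i f) x"
    using pq by (intro lim small) auto
  moreover have "(\<lambda>n. partial_deriv i (partial_deriv j f) (x + p' n *\<^sub>R axis j 1 + q' n *\<^sub>R axis i 1))
      \<longlonglongrightarrow> partial_deriv i (partial_deriv j f) x"
    using pq' by (intro lim small) auto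
  ultimately show "partial_deriv i (partial_deriv j f) x = partial_deriv j (partial_deriv i f) x"
    by (simp add: LIMSEQ_unique)
qed

section \<open>Decay and integration over Euclidean space\<close>

text \<open>The exponent provides one factor \<open>1 + (norm x)\<^sup>2\<close> per coordinate,
  which makes the weight integrable. Continuity supplies measurability.\<close>

definition dominated :: "('a::euclidean_space \<Rightarrow> real) \<Rightarrow> bool" where
  "dominated f \<longleftrightarrow> continuous_on UNIV f \<and>
     (\<exists>C. \<forall>x. \<bar>f x\<bar> \<le> C * inverse ((1 + (norm x)\<^sup>2) ^ DIM('a)))"

section \<open>Algebraic closure of dominated functions\<close>

lemma dominated_add:
  assumes "dominated f" "dominated g"
  shows "dominated (\<lambda>x. f x + g x)"
proof -
  obtain C D where C: "\<bar>f x\<bar> \<le> C * inverse ((1 + (norm x)\<^sup>2) ^ DIM('a))"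
    and D: "\<bar>g x\<bar> \<le> D * inverse ((1 + (norm x)\<^sup>2) ^ DIM('a))" for x
    using assms unfolding dominated_def by blast
  have "\<bar>f x + g x\<bar> \<le> (C + D) * inverse ((1 + (norm x)\<^sup>2) ^ DIM('a))" for x
    using add_mono[OF C D, of x x] abs_triangle_ineq[of "f x" "g x"] by (simp only: distrib_right)
  then show ?thesis
    using assms unfolding dominated_def by (blast intro: continuous_on_add)
qed

lemma dominated_mult_bounded:
  assumes "dominated f" "continuous_on UNIV g" "\<And>x. \<bar>g x\<bar> \<le> B"
  shows "dominated (\<lambda>x. g x * f x)"
proof -
  obtain C where C: "\<bar>f x\<bar> \<le> C * inverse ((1 + (norm x)\<^sup>2) ^ DIM('a))" for x
    using assms unfolding dominated_def by blast
  have "\<bar>g x * f x\<bar> \<le> B * (C * inverse ((1 + (norm x)\<^sup>2) ^ DIM('a)))" for x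
    using mult_mono[OF assms(3) C, of x x] order_trans[OF abs_ge_zero assms(3)] by (simp add: abs_mult)
  then have "\<exists>D. \<forall>x. \<bar>g x * f x\<bar> \<le> D * inverse ((1 + (norm x)\<^sup>2) ^ DIM('a))"
    by (intro exI[of _ "B * C"]) (simp add: mult_ac)
  then show ?thesis
    using assms(1,2) unfolding dominated_def by (blast intro: continuous_on_mult)
qed

lemma dominated_scale: "dominated f \<Longrightarrow> dominated (\<lambda>x. c * f x)"
  by (rule dominated_mult_bounded[of f "\<lambda>_. c" "\<bar>c\<bar>"]) auto

lemma dominated_diff:
  assumes "dominated f" "dominated g"
  shows "dominated (\<lambda>x. f x - g x)"
  using dominated_add[OF assms(1) dominated_scale[OF assms(2), of "-1"]] by simp

text \<open>The weight is at most 1, so the first factor is bounded and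
  \<open>dominated_mult_bounded\<close> applies.\<close>

lemma dominated_mult:
  assumes "dominated f" "dominated g"
  shows "dominated (\<lambda>x. f x * g x)"
proof -
  obtain C where C: "\<bar>f x\<bar> \<le> C * inverse ((1 + (norm x)\<^sup>2) ^ DIM('a))" for x
    using assms unfolding dominated_def by blast
  have "\<bar>f x\<bar> \<le> \<bar>C\<bar>" for x
  proof -
    have "inverse ((1 + (norm x)\<^sup>2) ^ DIM('a)) \<le> 1"
      by (intro inverse_le_1_iff[THEN iffD2] disjI2 one_le_power) simp
    then have "\<bar>C\<bar> * inverse ((1 + (norm x)\<^sup>2) ^ DIM('a)) \<le> \<bar>C\<bar>"
      by (rule mult_left_le) simp
    moreover have "C * inverse ((1 + (norm x)\<^sup>2) ^ DIM('a)) \<le> \<bar>C\<bar> * inverse ((1 + (norm x)\<^sup>2) ^ DIM('a))"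
      by (intro mult_right_mono) auto
    ultimately show ?thesis
      using C[of x] by linarith
  qed
  then show ?thesis
    using assms by (intro dominated_mult_bounded) (auto simp: dominated_def)
qed

lemma dominated_sum:
  assumes "\<And>i. i \<in> I \<Longrightarrow> dominated (f i)"
  shows "dominated (\<lambda>x. \<Sum>i\<in>I. f i x)"
proof -
  \<comment> \<open>The zero function covers the empty index set and also an infinite one, over
    which a sum is 0 by convention.\<close>
  have "dominated (\<lambda>_. 0 :: real)"
    unfolding dominated_def by (auto intro: exI[of _ 0])
  then show ?thesis
    using assms by (induction I rule: infinite_finite_induct) (auto intro: dominated_add)
qed

text \<open>Each coordinate satisfies \<open>\<bar>x \<bullet> b\<bar> \<le> norm x\<close>, so the
  weight lies below the product of the functions
  \<open>inverse (1 + (x \<bullet> b)\<^sup>2)\<close>. The integral of that product factors into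
  finite one-dimensional integrals.\<close>

lemma integrable_weight:
  "integrable lborel (\<lambda>x::'a::euclidean_space. inverse ((1 + (norm x)\<^sup>2) ^ DIM('a)))"
proof (rule integrableI_bounded)
  have "integrable lborel (\<lambda>x::real. inverse (1 + x\<^sup>2))"
    using integrable_inverse_1_plus_square by (simp add: set_integrable_def)
  then have fin: "(\<integral>\<^sup>+x. ennreal (inverse (1 + x\<^sup>2)) \<partial>(lborel :: real measure)) < \<infinity>"
    by (simp add: integrable_iff_bounded)
  have "(\<integral>\<^sup>+x. ennreal (norm (inverse ((1 + (norm x)\<^sup>2) ^ DIM('a)))) \<partial>(lborel :: 'a measure))
      \<le> (\<integral>\<^sup>+x. (\<Prod>b\<in>Basis. ennreal (inverse (1 + (x \<bullet> b)\<^sup>2))) \<partial>(lborel :: 'a measure))"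
  proof (rule nn_integral_mono)
    fix x :: 'a
    have "(\<Prod>b\<in>(Basis :: 'a set). inverse (1 + (norm x)\<^sup>2)) \<le> (\<Prod>b\<in>Basis. inverse (1 + (x \<bullet> b)\<^sup>2))"
    proof (rule prod_mono, safe)
      fix b :: 'a
      assume "b \<in> Basis"
      then have "\<bar>x \<bullet> b\<bar> \<le> norm x"
        by (rule Basis_le_norm)
      then have "(x \<bullet> b)\<^sup>2 \<le> (norm x)\<^sup>2"
        by (metis abs_le_square_iff abs_norm_cancel)
      then show "inverse (1 + (norm x)\<^sup>2) \<le> inverse (1 + (x \<bullet> b)\<^sup>2)"
        by (intro le_imp_inverse_le) (auto intro: add_pos_nonneg)
    qed auto
    then have "inverse ((1 + (norm x)\<^sup>2) ^ DIM('a)) \<le> (\<Prod>b\<in>Basis. inverse (1 + (x \<bullet> b)\<^sup>2))"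
      by (simp add: power_inverse)
    then show "ennreal (norm (inverse ((1 + (norm x)\<^sup>2) ^ DIM('a))))
        \<le> (\<Prod>b\<in>Basis. ennreal (inverse (1 + (x \<bullet> b)\<^sup>2)))"
      by (subst prod_ennreal) (auto intro!: ennreal_leI)
  qed
  also have "\<dots> = (\<Prod>b\<in>(Basis :: 'a set). \<integral>\<^sup>+x. ennreal (inverse (1 + x\<^sup>2)) \<partial>(lborel :: real measure))"
    by (subst nn_integral_lborel_prod) auto
  also have "\<dots> < \<infinity>"
    using fin by (simp add: power_less_top_ennreal)
  finally show "(\<integral>\<^sup>+x. ennreal (norm (inverse ((1 + (norm x)\<^sup>2) ^ DIM('a)))) \<partial>(lborel :: 'a measure)) < \<infinity>" .
qed auto

lemma dominated_integrable:
  fixes f :: "'a::euclidean_space \<Rightarrow> real"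
  assumes "dominated f"
  shows "integrable lborel f"
proof -
  obtain C where C: "\<bar>f x\<bar> \<le> C * inverse ((1 + (norm x)\<^sup>2) ^ DIM('a))" for x
    using assms unfolding dominated_def by blast
  have "f \<in> borel_measurable lborel"
    using assms by (simp add: dominated_def borel_measurable_continuous_onI)
  then show ?thesis
    using C by (intro Bochner_Integration.integrable_bound[OF integrable_mult_right[OF integrable_weight, of C]])
      (auto intro!: AE_I2 order_trans[OF _ abs_ge_self])
qed

text \<open>With r the norm of \<open>x + v\<close>, the norm of \<open>x\<close> is at most r + 1,
  and the square of r + 1 is at most twice the square of r plus 2. This yields the factor 3 for each
  power.\<close>

lemma weight_translate:
  fixes x v :: "'a::euclidean_space"
  assumes "norm v \<le> 1"
  shows "inverse ((1 + (norm (x + v))\<^sup>2) ^ DIM('a)) \<le> 3 ^ DIM('a) * inverse ((1 + (norm x)\<^sup>2) ^ DIM('a))"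
proof -
  have "norm x \<le> norm (x + v) + 1"
    using norm_triangle_ineq4[of "x + v" v] assms by simp
  then have "(norm x)\<^sup>2 \<le> (norm (x + v) + 1)\<^sup>2"
    by (simp add: power_mono)
  also have "\<dots> \<le> 2 * (norm (x + v))\<^sup>2 + 2"
    using sum_squares_bound[of "norm (x + v)" 1] by (simp add: power2_sum)
  finally have "(norm x)\<^sup>2 \<le> 2 * (norm (x + v))\<^sup>2 + 2" .
  moreover have "1 + a \<le> 3 * (1 + b)" if "a \<le> 2 * b + 2" "0 \<le> b" for a b :: real
    using that by simp
  ultimately have "1 + (norm x)\<^sup>2 \<le> 3 * (1 + (norm (x + v))\<^sup>2)"
    by (meson zero_le_power2)
  then have "(1 + (norm x)\<^sup>2) ^ DIM('a) \<le> 3 ^ DIM('a) * (1 + (norm (x + v))\<^sup>2) ^ DIM('a)"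
    unfolding power_mult_distrib[symmetric] by (rule power_mono) simp
  moreover have pos: "(1 + (norm y)\<^sup>2) ^ DIM('a) > 0" for y :: 'a
    by (intro zero_less_power add_pos_nonneg) auto
  moreover have "inverse b \<le> c * inverse a" if "a \<le> c * b" "a > 0" "b > 0" for a b c :: real
    using that by (simp add: field_simps)
  ultimately show ?thesis
    by blast
qed

text \<open>The mean value theorem identifies each difference quotient with a value of
  \<open>f'\<close> at a point displaced by at most 1. Hence \<open>weight_translate\<close> gives
  an integrable bound that does not depend on the step size.\<close>

lemma integral_directional_derivative_eq_0:
  fixes f f' :: "'a::euclidean_space \<Rightarrow> real"
  assumes deriv: "\<And>x. ((\<lambda>s. f (x + s *\<^sub>R v)) has_real_derivative f' x) (at 0)"
    and v: "norm v \<le> 1"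
    and f: "dominated f" and f': "dominated f'"
  shows "(LINT x|lborel. f' x) = 0"
proof -
  obtain C where C: "\<bar>f' x\<bar> \<le> C * inverse ((1 + (norm x)\<^sup>2) ^ DIM('a))" for x
    using f' unfolding dominated_def by blast
  have C0: "C \<ge> 0"
    using C[of 0] by simp
  define h where "h n = inverse (real (Suc n))" for n
  have h: "0 < h n" "h n \<le> 1" for n
    by (simp_all add: h_def field_simps)
  have h0: "h \<longlonglongrightarrow> 0"
    unfolding h_def by (rule LIMSEQ_inverse_real_of_nat)
  define q where "q n x = (f (x + h n *\<^sub>R v) - f x) / h n" for n x
  \<comment> \<open>The assumption at the base point \<open>x + s *\<^sub>R v\<close> gives
    differentiability along the whole line.\<close>
  have deriv_at: "((\<lambda>s. f (x + s *\<^sub>R v)) has_real_derivative f' (x + s *\<^sub>R v)) (at s)" for x s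
    using deriv[of "x + s *\<^sub>R v"] DERIV_at_within_shift[of "\<lambda>r. f (x + r *\<^sub>R v)" "f' (x + s *\<^sub>R v)" s 0 UNIV]
    by (simp add: algebra_simps)
  have int_f: "integrable lborel f"
    by (rule dominated_integrable[OF f])
  have q0: "(LINT x|lborel. q n x) = 0" for n
  proof -
    have m: "(\<lambda>x. h n *\<^sub>R v + x) \<in> measurable lborel lborel"
      by simp
    have mf: "f \<in> borel_measurable lborel"
      using int_f by (rule borel_measurable_integrable)
    have "integrable lborel (\<lambda>x. f (h n *\<^sub>R v + x))"
      using integrable_distr[OF m] int_f by (metis lborel_distr_plus distr_cong sets_lborel)
    moreover have "(LINT x|lborel. f (h n *\<^sub>R v + x)) = (LINT x|lborel. f x)"
      using integral_distr[OF m mf] by (metis lborel_distr_plus distr_cong sets_lborel)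
    ultimately show ?thesis
      using int_f by (simp add: q_def add.commute)
  qed
  have bound: "norm (q n x) \<le> C * 3 ^ DIM('a) * inverse ((1 + (norm x)\<^sup>2) ^ DIM('a))" for n x
  proof -
    have "\<exists>\<xi>>0. \<xi> < h n \<and> f (x + h n *\<^sub>R v) - f (x + 0 *\<^sub>R v) = (h n - 0) * f' (x + \<xi> *\<^sub>R v)"
      by (intro MVT2 deriv_at h)
    then obtain \<xi> where \<xi>: "0 < \<xi>" "\<xi> < h n" "f (x + h n *\<^sub>R v) - f x = h n * f' (x + \<xi> *\<^sub>R v)"
      by auto
    have "norm (\<xi> *\<^sub>R v) \<le> 1"
      using \<xi> h[of n] v mult_mono[of \<xi> 1 "norm v" 1] by simp
    note w = weight_translate[OF this, of x]
    have "q n x = f' (x + \<xi> *\<^sub>R v)"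
      using \<xi> h[of n] by (simp add: q_def)
    then show ?thesis
      using C[of "x + \<xi> *\<^sub>R v"] mult_left_mono[OF w C0] by simp
  qed
  have "(\<lambda>n. LINT x|lborel. q n x) \<longlonglongrightarrow> (LINT x|lborel. f' x)"
  proof (rule integral_dominated_convergence)
    show "f' \<in> borel_measurable lborel"
      using dominated_integrable[OF f'] by (rule borel_measurable_integrable)
    have "continuous_on UNIV f"
      using f by (simp add: dominated_def)
    then have "continuous_on UNIV (\<lambda>x. f (x + h n *\<^sub>R v))" for n
      by (rule continuous_on_compose2) (auto intro!: continuous_intros)
    then show "q n \<in> borel_measurable lborel" for n
      unfolding q_def using \<open>continuous_on UNIV f\<close> h(1)[of n]
      by (auto intro!: borel_measurable_continuous_onI continuous_intros)
    show "integrable lborel (\<lambda>x::'a. C * 3 ^ DIM('a) * inverse ((1 + (norm x)\<^sup>2) ^ DIM('a)))"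
      by (rule integrable_mult_right[OF integrable_weight])
    show "AE x in lborel. norm (q n x) \<le> C * 3 ^ DIM('a) * inverse ((1 + (norm x)\<^sup>2) ^ DIM('a))" for n
      using bound by simp
    have "(\<lambda>n. q n x) \<longlonglongrightarrow> f' x" for x
    proof -
      have "((\<lambda>s. (f (x + s *\<^sub>R v) - f x) / s) \<longlongrightarrow> f' x) (at 0)"
        using deriv[of x] by (simp add: DERIV_def)
      moreover have "filterlim h (at 0) sequentially"
        using h0 h(1) by (auto simp: filterlim_at less_imp_neq[symmetric] intro!: always_eventually)
      ultimately show ?thesis
        unfolding q_def by (rule filterlim_compose)
    qed
    then show "AE x in lborel. (\<lambda>n. q n x) \<longlonglongrightarrow> f' x"
      by simp
  qed
  then show ?thesis
    by (simp add: q0 LIMSEQ_const_iff)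
qed

lemma rapidly_decreasing_partial_deriv:
  assumes "rapidly_decreasing f"
  shows "rapidly_decreasing (partial_deriv i f)"
proof -
  have "\<exists>C. \<forall>x. norm x ^ k * \<bar>partials ks (partial_deriv i f) x\<bar> \<le> C" for k ks
    using assms unfolding rapidly_decreasing_def by (metis partials_simps(2))
  then show ?thesis
    using assms smooth_partial_deriv unfolding rapidly_decreasing_def by blast
qed

text \<open>The decay bounds with exponents 0 and twice the dimension are combined through
  \<open>(1 + r) ^ n \<le> 2 ^ n * (1 + r ^ n)\<close>, where r is the squared norm and n the
  dimension.\<close>

lemma rapidly_decreasing_dominated:
  fixes f :: "real^'n::finite \<Rightarrow> real"
  assumes "rapidly_decreasing f"
  shows "dominated f"
proof -
  let ?d = "DIM(real^'n)"
  have *: "\<exists>C. \<forall>x. norm x ^ k * \<bar>f x\<bar> \<le> C" for k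
    using assms unfolding rapidly_decreasing_def by (metis partials_simps(1))
  obtain A where A: "norm x ^ 0 * \<bar>f x\<bar> \<le> A" for x
    using *[of 0] by blast
  obtain B where B: "norm x ^ (2 * ?d) * \<bar>f x\<bar> \<le> B" for x
    using *[of "2 * ?d"] by blast
  have "\<bar>f x\<bar> \<le> 2 ^ ?d * (A + B) * inverse ((1 + (norm x)\<^sup>2) ^ ?d)" for x
  proof -
    have pow: "(1 + r) ^ n \<le> 2 ^ n * (1 + r ^ n)" if "0 \<le> r" for r :: real and n
    proof (cases "r \<le> 1")
      case True
      then have "(1 + r) ^ n \<le> 2 ^ n"
        using that by (intro power_mono) auto
      also have "\<dots> \<le> 2 ^ n * (1 + r ^ n)"
        using that by simp
      finally show ?thesis .
    next
      case False
      then have "(1 + r) ^ n \<le> (2 * r) ^ n"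
        by (intro power_mono) auto
      also have "\<dots> \<le> 2 ^ n * (1 + r ^ n)"
        by (simp add: power_mult_distrib)
      finally show ?thesis .
    qed
    have "(1 + (norm x)\<^sup>2) ^ ?d * \<bar>f x\<bar> \<le> 2 ^ ?d * (1 + ((norm x)\<^sup>2) ^ ?d) * \<bar>f x\<bar>"
      by (intro mult_right_mono pow) auto
    also have "\<dots> = 2 ^ ?d * (norm x ^ 0 * \<bar>f x\<bar> + norm x ^ (2 * ?d) * \<bar>f x\<bar>)"
      by (simp only: power_mult power_0 distrib_left distrib_right mult.assoc mult_1_left)
    also have "\<dots> \<le> 2 ^ ?d * (A + B)"
      by (intro mult_left_mono add_mono A B) simp
    finally have "(1 + (norm x)\<^sup>2) ^ ?d * \<bar>f x\<bar> \<le> 2 ^ ?d * (A + B)" .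
    moreover have "(1 + (norm x)\<^sup>2) ^ ?d > 0"
      by (intro zero_less_power add_pos_nonneg) auto
    moreover have "b \<le> c * inverse a" if "a * b \<le> c" "a > 0" for a b c :: real
      using that by (simp add: field_simps)
    ultimately show ?thesis
      by blast
  qed
  moreover have "continuous_on UNIV f"
    using assms by (simp add: rapidly_decreasing_def smooth_isCont continuous_at_imp_continuous_on)
  ultimately show ?thesis
    unfolding dominated_def by blast
qed

section \<open>Fields on the slices of constant time\<close>

text \<open>\<open>UNIV_4\<close> lists the indices as 1, 2, 3, 4; as 4 = 0 in this type, the time
  index can be put first.\<close>

lemma UNIV_4_from_0: "(UNIV :: 4 set) = {0, 1, 2, 3}"
proof -
  have "(4 :: 4) = 0"
    by simp
  then show ?thesis
    unfolding UNIV_4 by auto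
qed

lemma sum_4_from_0: "sum f (UNIV :: 4 set) = f 0 + f 1 + f 2 + f (3 :: 4)"
  unfolding UNIV_4_from_0 by (simp add: add.assoc)

lemma forall_4_from_0: "(\<forall>i. P i) \<longleftrightarrow> P 0 \<and> P 1 \<and> P 2 \<and> P (3 :: 4)"
  using UNIV_4_from_0 by (metis UNIV_I empty_iff insert_iff)

text \<open>Moving in a spatial direction stays inside the slice. The index \<open>k\<close> is
  obtained existentially because \<open>j\<close> and \<open>k\<close> have different types, in
  which the literal 3 denotes different residues.\<close>

lemma event_shift:
  assumes "j \<in> {1, 2, 3}"
  obtains k where "\<And>t x s. event t (x + s *\<^sub>R axis k 1) = event t x + s *\<^sub>R axis j 1"
proof -
  have "event t (x + s *\<^sub>R axis 1 1) = event t x + s *\<^sub>R axis 1 1"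
    "event t (x + s *\<^sub>R axis 2 1) = event t x + s *\<^sub>R axis 2 1"
    "event t (x + s *\<^sub>R axis 3 1) = event t x + s *\<^sub>R axis 3 1" for t x s
    unfolding vec_eq_iff forall_4_from_0 by (simp_all add: event_def axis_def)
  then show thesis
    using that assms by blast
qed

text \<open>Spatial differentiation commutes with restriction to the slice, since both differentiate
  along the same line.\<close>

lemma slice_partial_deriv:
  assumes "j \<in> {1, 2, 3}" "rapidly_decreasing (\<lambda>x. F (event t x))"
  shows "rapidly_decreasing (\<lambda>x. partial_deriv j F (event t x))"
proof -
  obtain k where "\<And>t x s. event t (x + s *\<^sub>R axis k 1) = event t x + s *\<^sub>R axis j 1"
    using event_shift[OF assms(1)] by blast
  then have "(\<lambda>x. partial_deriv j F (event t x)) = partial_deriv k (\<lambda>x. F (event t x))"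
    by (simp add: partial_deriv_def fun_eq_iff)
  then show ?thesis
    using rapidly_decreasing_partial_deriv[OF assms(2)] by simp
qed

text \<open>This collects what \<open>integral_directional_derivative_eq_0\<close> requires of one
  component, in a form stable under sums and multiples. The derivative clause is explicit because a
  value of \<open>deriv\<close> does not imply differentiability.\<close>

definition vanishing_flux :: "real \<Rightarrow> 4 \<Rightarrow> scalar_field \<Rightarrow> bool" where
  "vanishing_flux t j F \<longleftrightarrow>
     (\<forall>x. ((\<lambda>s. F (x + s *\<^sub>R axis j 1)) has_real_derivative partial_deriv j F x) (at 0)) \<and>
     dominated (\<lambda>x. F (event t x)) \<and> dominated (\<lambda>x. partial_deriv j F (event t x))"

lemma partial_deriv_eqI:
  "((\<lambda>s. F (x + s *\<^sub>R axis j 1)) has_real_derivative D) (at 0) \<Longrightarrow> partial_deriv j F x = D"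
  unfolding partial_deriv_def by (rule DERIV_imp_deriv)

lemma smooth_has_partial_deriv_0:
  assumes "smooth f"
  shows "((\<lambda>s. f (x + s *\<^sub>R axis i 1)) has_real_derivative partial_deriv i f x) (at 0)"
  using smooth_has_partial_deriv[OF assms, of x i 0] by simp

text \<open>Uniqueness of derivatives lets the conditions be checked on an explicit formula
  \<open>D\<close> found by differentiation rules.\<close>

lemma vanishing_fluxI:
  assumes "\<And>x. ((\<lambda>s. F (x + s *\<^sub>R axis j 1)) has_real_derivative D x) (at 0)"
    and "dominated (\<lambda>x. F (event t x))" and "dominated (\<lambda>x. D (event t x))"
  shows "vanishing_flux t j F"
proof -
  have "partial_deriv j F = D"
    using partial_deriv_eqI[OF assms(1)] by blast
  then show ?thesis
    using assms by (simp add: vanishing_flux_def)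
qed

lemma vanishing_flux_add:
  assumes "vanishing_flux t j F" "vanishing_flux t j G"
  shows "vanishing_flux t j (\<lambda>x. F x + G x)"
  by (rule vanishing_fluxI[of _ j "\<lambda>x. partial_deriv j F x + partial_deriv j G x"])
     (use assms in \<open>auto simp: vanishing_flux_def intro: DERIV_add dominated_add\<close>)

lemma vanishing_flux_scale:
  assumes "vanishing_flux t j F"
  shows "vanishing_flux t j (\<lambda>x. c * F x)"
  by (rule vanishing_fluxI[of _ j "\<lambda>x. c * partial_deriv j F x"])
     (use assms in \<open>auto simp: vanishing_flux_def intro: DERIV_cmult dominated_scale\<close>)

lemma vanishing_flux_mult:
  assumes "j \<in> {1, 2, 3}" "smooth f" "smooth g"
    and f: "rapidly_decreasing (\<lambda>x. f (event t x))"
    and g: "rapidly_decreasing (\<lambda>x. g (event t x))"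
  shows "vanishing_flux t j (\<lambda>x. f x * g x)"
proof (rule vanishing_fluxI)
  show "((\<lambda>s. f (x + s *\<^sub>R axis j 1) * g (x + s *\<^sub>R axis j 1)) has_real_derivative
      partial_deriv j f x * g x + partial_deriv j g x * f x) (at 0)" for x
    using DERIV_mult[OF smooth_has_partial_deriv_0[OF assms(2), of x j]
        smooth_has_partial_deriv_0[OF assms(3), of x j]] by simp
qed (intro dominated_add dominated_mult rapidly_decreasing_dominated slice_partial_deriv assms)+

text \<open>Pulled back to the slice, the derivative in direction \<open>j\<close> is one along the
  unit vector \<open>axis k 1\<close> of space.\<close>

lemma vanishing_flux_integral:
  assumes "j \<in> {1, 2, 3}" "vanishing_flux t j F"
  shows "slice_integrable (partial_deriv j F) t" "slice_integral (partial_deriv j F) t = 0"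
proof -
  show "slice_integrable (partial_deriv j F) t"
    using assms(2) by (simp add: slice_integrable_def vanishing_flux_def dominated_integrable)
  obtain k where k: "\<And>t x s. event t (x + s *\<^sub>R axis k 1) = event t x + s *\<^sub>R axis j 1"
    using event_shift[OF assms(1)] by blast
  show "slice_integral (partial_deriv j F) t = 0"
    unfolding slice_integral_def
    by (rule integral_directional_derivative_eq_0[where f = "\<lambda>x. F (event t x)" and v = "axis k 1"])
      (use assms(2) in \<open>auto simp: k vanishing_flux_def\<close>)
qed

lemma slice_integral_spatial_divergence_eq_0:
  assumes "\<And>j. j \<in> {1, 2, 3} \<Longrightarrow> vanishing_flux t j (V j)"
  shows "slice_integral (spatial_divergence V) t = 0"
proof -
  have "integrable lborel (\<lambda>x. partial_deriv j (V j) (event t x))"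
    "(LINT x|lborel. partial_deriv j (V j) (event t x)) = 0" if "j \<in> {1, 2, 3}" for j
    using vanishing_flux_integral[OF that assms[OF that]]
    by (simp_all add: slice_integrable_def slice_integral_def)
  then show ?thesis
    unfolding slice_integral_def spatial_divergence_def
    by (subst Bochner_Integration.integral_sum) auto
qed

lemma smooth_partials: "smooth f \<Longrightarrow> smooth (partials ks f)"
  by (induction ks arbitrary: f) (auto intro: smooth_partial_deriv)

lemma slice_partials:
  assumes "set ks \<subseteq> {1, 2, 3}" "rapidly_decreasing (\<lambda>x. F (event t x))"
  shows "rapidly_decreasing (\<lambda>x. partials ks F (event t x))"
  using assms by (induction ks arbitrary: F) (auto intro: slice_partial_deriv)

lemma dominated_scale_right: "dominated f \<Longrightarrow> dominated (\<lambda>x. f x * c)"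
  using dominated_scale[of f c] by (simp add: mult.commute)

lemma dominated_divide: "dominated f \<Longrightarrow> dominated (\<lambda>x. f x / c)"
  using dominated_scale[of f "1 / c"] by simp

text \<open>Constant factors have rules of their own, since a nonzero constant is not
  \<open>dominated\<close>.\<close>

lemmas dominated_intros = dominated_add dominated_diff dominated_sum dominated_divide
  dominated_scale dominated_scale_right dominated_mult

lemma vanishing_flux_sum:
  assumes "\<And>i. i \<in> I \<Longrightarrow> vanishing_flux t j (F i)"
  shows "vanishing_flux t j (\<lambda>x. \<Sum>i\<in>I. F i x)"
proof -
  have "dominated (\<lambda>_::real^3. 0)"
    using dominated_sum[of "{}"] by simp
  then have "vanishing_flux t j (\<lambda>_. 0)"
    by (intro vanishing_fluxI[where D = "\<lambda>_. 0"]) auto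
  then show ?thesis
    using assms by (induction I rule: infinite_finite_induct) (auto intro: vanishing_flux_add)
qed

section \<open>The fluxes\<close>

lemma quadratic_expression_mult:
  "quadratic_expression (\<lambda>\<phi> x. partials p \<phi> x * partials q \<phi> x)"
  unfolding quadratic_expression_def by (rule exI[of _ "[(1, p, q)]"]) simp

lemma quadratic_expression_scale:
  assumes "quadratic_expression F"
  shows "quadratic_expression (\<lambda>\<phi> x. a * F \<phi> x)"
proof -
  obtain ts where ts: "\<And>\<phi> x. F \<phi> x = (\<Sum>(c, p, q)\<leftarrow>ts. c * partials p \<phi> x * partials q \<phi> x)"
    using assms unfolding quadratic_expression_def by blast
  have "a * F \<phi> x = (\<Sum>(c, p, q)\<leftarrow>map (\<lambda>(c, p, q). (a * c, p, q)) ts.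
      c * partials p \<phi> x * partials q \<phi> x)" for \<phi> x
    unfolding ts sum_list_const_mult[symmetric]
    by (simp add: o_def case_prod_unfold mult.assoc)
  then show ?thesis
    unfolding quadratic_expression_def by blast
qed

lemma quadratic_expression_add:
  assumes "quadratic_expression F" "quadratic_expression G"
  shows "quadratic_expression (\<lambda>\<phi> x. F \<phi> x + G \<phi> x)"
proof -
  obtain ts us where
    "\<And>\<phi> x. F \<phi> x = (\<Sum>(c, p, q)\<leftarrow>ts. c * partials p \<phi> x * partials q \<phi> x)"
    "\<And>\<phi> x. G \<phi> x = (\<Sum>(c, p, q)\<leftarrow>us. c * partials p \<phi> x * partials q \<phi> x)"
    using assms unfolding quadratic_expression_def by metis
  then have "F \<phi> x + G \<phi> x = (\<Sum>(c, p, q)\<leftarrow>ts @ us. c * partials p \<phi> x * partials q \<phi> x)" for \<phi> x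
    by simp
  then show ?thesis
    unfolding quadratic_expression_def by blast
qed

lemma quadratic_expression_sum:
  assumes "\<And>i. i \<in> I \<Longrightarrow> quadratic_expression (F i)"
  shows "quadratic_expression (\<lambda>\<phi> x. \<Sum>i\<in>I. F i \<phi> x)"
proof -
  have "quadratic_expression (\<lambda>_ _. 0)"
    unfolding quadratic_expression_def by (rule exI[of _ "[]"]) simp
  then show ?thesis
    using assms by (induction I rule: infinite_finite_induct) (auto intro: quadratic_expression_add)
qed

text \<open>By the field equation, the difference of the energy densities is
  \<open>1/4 (\<phi>\<^sub>,\<^sub>i\<^sub>j \<phi>\<^sub>,\<^sub>i\<^sub>j - (\<Delta>\<phi>)\<^sup>2) + m\<^sup>2/2 (\<phi>\<^sub>,\<^sub>i \<phi>\<^sub>,\<^sub>i + \<phi> \<Delta>\<phi>)\<close>. The difference of the momentum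
  densities is \<open>-\<tau>\<^sup>i\<^sup>0/2 = 1/2 (\<phi>\<^sub>,\<^sub>0\<^sub>i \<Delta>\<phi> - \<phi>\<^sub>,\<^sub>i\<^sub>k \<phi>\<^sub>,\<^sub>0\<^sub>k - m\<^sup>2 \<partial>\<^sub>i(\<phi> \<phi>\<^sub>,\<^sub>0))\<close>.\<close>

definition superenergy_flux :: "real \<Rightarrow> 4 \<Rightarrow> scalar_field \<Rightarrow> scalar_field" where
  "superenergy_flux m j \<phi> x =
     (\<Sum>i\<in>{1, 2, 3}. 1/4 * (partials [i] \<phi> x * partials [i, j] \<phi> x)
                     + (- 1/4) * (partials [j] \<phi> x * partials [i, i] \<phi> x))
     + m\<^sup>2 / 2 * (partials [] \<phi> x * partials [j] \<phi> x)"

text \<open>The divergence of the first product gives the wanted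
  \<open>\<phi>\<^sub>,\<^sub>0\<^sub>i \<Delta>\<phi>\<close> and an unwanted third-order term,
  which the diagonal part cancels while producing the remaining terms. The Kronecker delta is a
  numerical coefficient and \<open>partials []\<close> stands for the field itself, so the closure
  rules for quadratic expressions apply directly.\<close>

definition supermomentum_flux :: "real \<Rightarrow> 4 \<Rightarrow> 4 \<Rightarrow> scalar_field \<Rightarrow> scalar_field" where
  "supermomentum_flux m i j \<phi> x =
     1/2 * (partials [0, i] \<phi> x * partials [j] \<phi> x)
     + (if i = j then - 1/2 else 0) *
         ((\<Sum>k\<in>{1, 2, 3}. partials [k] \<phi> x * partials [0, k] \<phi> x)
          + m\<^sup>2 * (partials [] \<phi> x * partials [0] \<phi> x))"

lemma quadratic_superenergy_flux: "quadratic_expression (superenergy_flux m j)"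
  unfolding superenergy_flux_def[abs_def]
  by (intro quadratic_expression_add quadratic_expression_sum quadratic_expression_scale
      quadratic_expression_mult)

lemma quadratic_supermomentum_flux: "quadratic_expression (supermomentum_flux m i j)"
  unfolding supermomentum_flux_def[abs_def]
  by (intro quadratic_expression_add quadratic_expression_sum quadratic_expression_scale
      quadratic_expression_mult)

text \<open>The metric is diagonal, so raising an index amounts to multiplication by the sign
  \<open>eta \<alpha> \<alpha>\<close>.\<close>

lemma sum_eta: "(\<Sum>\<mu>\<in>UNIV. eta \<alpha> \<mu> * f \<mu>) = eta \<alpha> \<alpha> * f \<alpha>"
proof -
  have "(\<Sum>\<mu>\<in>UNIV. eta \<alpha> \<mu> * f \<mu>) = (\<Sum>\<mu>\<in>UNIV. if \<mu> = \<alpha> then eta \<alpha> \<alpha> * f \<alpha> else 0)"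
    by (intro sum.cong) (auto simp: eta_def)
  then show ?thesis
    by simp
qed

lemma d_up_eq: "d_up \<phi> \<alpha> x = eta \<alpha> \<alpha> * partials [\<alpha>] \<phi> x"
  unfolding d_up_def by (rule sum_eta)

lemma dd_mixed_eq: "dd_mixed \<phi> \<alpha> \<beta> x = eta \<alpha> \<alpha> * partials [\<alpha>, \<beta>] \<phi> x"
  unfolding dd_mixed_def by (rule sum_eta)

lemma dd_up_eq: "dd_up \<phi> \<alpha> \<beta> x = eta \<alpha> \<alpha> * eta \<beta> \<beta> * partials [\<alpha>, \<beta>] \<phi> x"
  unfolding dd_up_def by (simp only: mult.assoc sum_eta sum_distrib_left[symmetric])

lemma klein_gordon_partials_00:
  assumes "klein_gordon m \<phi>"
  shows "partials [0, 0] \<phi> x = (\<Sum>i\<in>{1, 2, 3}. partials [i, i] \<phi> x) - m\<^sup>2 * \<phi> x"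
proof -
  have "dalembertian \<phi> x = (\<Sum>\<alpha>\<in>UNIV. eta \<alpha> \<alpha> * partials [\<alpha>, \<alpha>] \<phi> x)"
    unfolding dalembertian_def by (simp only: sum_eta)
  moreover have "dalembertian \<phi> x + m\<^sup>2 * \<phi> x = 0"
    using assms unfolding klein_gordon_def by blast
  ultimately show ?thesis
    by (simp add: sum_4_from_0 eta_def algebra_simps)
qed

text \<open>Unfolding \<open>partials\<close> exposes iterated \<open>partial_deriv\<close> factors,
  to each of which \<open>smooth_has_partial_deriv_0\<close> applies; the product rule does the
  rest.\<close>

lemma partial_deriv_superenergy_flux:
  assumes "smooth \<phi>"
  shows "partial_deriv j (superenergy_flux m j \<phi>) x =
    (\<Sum>i\<in>{1, 2, 3}. 1/4 * ((partials [i, j] \<phi> x)\<^sup>2 + partials [i] \<phi> x * partials [i, j, j] \<phi> x)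
                    - 1/4 * (partials [j, j] \<phi> x * partials [i, i] \<phi> x + partials [j] \<phi> x * partials [i, i, j] \<phi> x))
     + m\<^sup>2 / 2 * ((partials [j] \<phi> x)\<^sup>2 + \<phi> x * partials [j, j] \<phi> x)"
proof (rule partial_deriv_eqI, unfold superenergy_flux_def partials_simps,
    (rule derivative_eq_intros smooth_has_partial_deriv_0 smooth_partial_deriv assms refl)+)
qed (simp add: algebra_simps power2_eq_square)

lemma partial_deriv_supermomentum_flux:
  assumes "smooth \<phi>"
  shows "partial_deriv j (supermomentum_flux m i j \<phi>) x =
     1/2 * (partials [0, i, j] \<phi> x * partials [j] \<phi> x + partials [0, i] \<phi> x * partials [j, j] \<phi> x)
     - (if i = j then 1/2 else 0) *
         ((\<Sum>k\<in>{1, 2, 3}. partials [k, j] \<phi> x * partials [0, k] \<phi> x + partials [k] \<phi> x * partials [0, k, j] \<phi> x)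
          + m\<^sup>2 * (partials [j] \<phi> x * partials [0] \<phi> x + \<phi> x * partials [0, j] \<phi> x))"
proof (rule partial_deriv_eqI, unfold supermomentum_flux_def partials_simps,
    (rule derivative_eq_intros smooth_has_partial_deriv_0 smooth_partial_deriv assms refl)+)
qed (simp add: algebra_simps)

text \<open>With all indices 0 the tensor is the square of
  \<open>\<phi>\<^sub>,\<^sub>0\<^sub>0\<close> minus \<open>\<tau>\<^sup>0\<^sup>0\<close>. In the
  divergence the third-order terms cancel when the double sum over spatial indices is
  reordered.\<close>

lemma superenergy_eq_weak_plus_divergence:
  assumes "smooth \<phi>" "klein_gordon m \<phi>"
  shows "superenergy_tensor m \<phi> 0 0 0 0 x
    = weak_superenergy_tensor m \<phi> 0 0 0 0 x + spatial_divergence (\<lambda>j. superenergy_flux m j \<phi>) x"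
proof -
  note KG = klein_gordon_partials_00[OF assms(2), of x, simplified]
  \<comment> \<open>As permutative rewrite rules these two equations sort derivatives of second and
    third order, so that equal monomials become syntactically equal.\<close>
  have comm: "partial_deriv a (partial_deriv b \<phi>) = partial_deriv b (partial_deriv a \<phi>)"
    "partial_deriv a (partial_deriv b (partial_deriv c \<phi>)) = partial_deriv b (partial_deriv a (partial_deriv c \<phi>))"
    for a b c
    by (intro smooth_partial_deriv_commute smooth_partial_deriv assms(1))+
  show ?thesis
    unfolding superenergy_tensor_def weak_superenergy_tensor_def tau_def invariant_K_def symm_def
      spatial_divergence_def partial_deriv_superenergy_flux[OF assms(1)] d_up_eq dd_up_eq dd_mixed_eq
      sum_4_from_0
    by (simp add: eta_def KG comm, simp add: field_simps power2_eq_square power4_eq_xxxx)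
qed

text \<open>Both tensors contain the product of \<open>\<phi>\<^sup>,\<^sup>i\<^sup>0\<close> and
  \<open>\<phi>\<^sup>,\<^sup>0\<^sup>0\<close>, leaving only the multiple of
  \<open>\<tau>\<^sup>i\<^sup>0\<close>. Splitting into the three values of \<open>i\<close> turns
  the metric and the Kronecker delta into numbers.\<close>

lemma supermomentum_eq_weak_plus_divergence:
  assumes "smooth \<phi>" "klein_gordon m \<phi>" "i \<in> {1, 2, 3}"
  shows "superenergy_tensor m \<phi> i 0 0 0 x
    = weak_superenergy_tensor m \<phi> i 0 0 0 x + spatial_divergence (\<lambda>j. supermomentum_flux m i j \<phi>) x"
proof -
  note KG = klein_gordon_partials_00[OF assms(2), of x, simplified]
  have comm: "partial_deriv a (partial_deriv b \<phi>) = partial_deriv b (partial_deriv a \<phi>)"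
    "partial_deriv a (partial_deriv b (partial_deriv c \<phi>)) = partial_deriv b (partial_deriv a (partial_deriv c \<phi>))"
    for a b c
    by (intro smooth_partial_deriv_commute smooth_partial_deriv assms(1))+
  from assms(3) consider "i = 1" | "i = 2" | "i = 3"
    by blast
  then show ?thesis
    unfolding superenergy_tensor_def weak_superenergy_tensor_def tau_def invariant_K_def symm_def
      spatial_divergence_def partial_deriv_supermomentum_flux[OF assms(1)] d_up_eq dd_up_eq dd_mixed_eq
      sum_4_from_0
    by cases (simp_all add: eta_def KG comm, simp_all add: field_simps power2_eq_square power4_eq_xxxx)
qed

text \<open>Integrability of both densities passes to their difference. It is a premise because the
  integral of a non-integrable function is 0 by convention.\<close>

lemma slice_integral_split:
  assumes "\<And>x. F x = G x + D x" "slice_integrable F t" "slice_integrable G t"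
  shows "slice_integrable D t" "slice_integral F t = slice_integral G t + slice_integral D t"
proof -
  have "D x = F x - G x" for x
    by (simp add: assms(1))
  then show D: "slice_integrable D t"
    using assms(2,3) by (simp add: slice_integrable_def)
  show "slice_integral F t = slice_integral G t + slice_integral D t"
    using assms(3) D by (simp add: slice_integral_def slice_integrable_def assms(1))
qed

section \<open>Solutions whose data decrease rapidly on a fixed slice\<close>

context
  fixes m t :: real and \<phi> :: scalar_field
  assumes sm: "smooth \<phi>" and kg: "klein_gordon m \<phi>"
    and rapid: "rapidly_decreasing (\<lambda>x. \<phi> (event t x))"
      "rapidly_decreasing (\<lambda>x. partials [0] \<phi> (event t x))"
begin

text \<open>The time index stands first, so the spatial derivatives act within the slice on
  \<open>\<phi>\<close> or on its time derivative.\<close>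

lemma slice_rapidly_decreasing:
  assumes "set ks \<subseteq> {1, 2, 3}"
  shows "rapidly_decreasing (\<lambda>x. partials ks \<phi> (event t x))"
    and "rapidly_decreasing (\<lambda>x. partials (0 # ks) \<phi> (event t x))"
  using slice_partials[OF assms rapid(1)] slice_partials[OF assms rapid(2)] by simp_all

text \<open>A spatial last index reduces to decay on the slice, two time indices to the field
  equation, and a time index after a spatial one to symmetry of second derivatives.\<close>

lemma dominated_partials_2: "dominated (\<lambda>x. partials [\<alpha>, \<beta>] \<phi> (event t x))"
proof -
  have index: "a = 0 \<or> a \<in> {1, 2, 3}" for a :: 4
    using UNIV_4_from_0 by auto
  have spatial: "dominated (\<lambda>x. partials [a, b] \<phi> (event t x))" if "b \<in> {1, 2, 3}" for a b
  proof (cases "a = 0")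
    case True
    then show ?thesis
      using slice_rapidly_decreasing(2)[of "[b]"] that by (simp add: rapidly_decreasing_dominated)
  next
    case False
    then show ?thesis
      using slice_rapidly_decreasing(1)[of "[a, b]"] that index[of a]
      by (simp add: rapidly_decreasing_dominated)
  qed
  have "dominated (\<lambda>x. partials [0, 0] \<phi> (event t x))"
    unfolding klein_gordon_partials_00[OF kg]
    by (intro dominated_intros spatial rapidly_decreasing_dominated rapid(1))
  moreover have "partials [\<alpha>, 0] \<phi> = partials [0, \<alpha>] \<phi>"
    using smooth_partial_deriv_commute[OF sm] by simp
  ultimately show ?thesis
    using spatial index by metis
qed

lemma dominated_partials_1: "dominated (\<lambda>x. partials [\<alpha>] \<phi> (event t x))"
proof (cases "\<alpha> = 0")
  case True
  then show ?thesis
    using rapidly_decreasing_dominated[OF rapid(2)] by simp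
next
  case False
  then have "set [\<alpha>] \<subseteq> {1, 2, 3}"
    using UNIV_4_from_0 by auto
  then show ?thesis
    by (intro rapidly_decreasing_dominated slice_rapidly_decreasing)
qed

lemma dominated_tau: "dominated (\<lambda>x. tau m \<phi> \<alpha> \<beta> (event t x))"
  \<comment> \<open>Only the square of the field is rewritten as a product; the powers of
    \<open>m\<close> remain constant coefficients.\<close>
  unfolding tau_def invariant_K_def d_up_eq dd_up_eq dd_mixed_eq power2_eq_square[of "\<phi> _"]
  by (intro dominated_intros dominated_partials_1 dominated_partials_2
      rapidly_decreasing_dominated rapid(1))

lemma slice_integrable_superenergy_tensor:
  "slice_integrable (superenergy_tensor m \<phi> \<alpha> \<beta> \<gamma> \<delta>) t"
  unfolding slice_integrable_def superenergy_tensor_def symm_def dd_up_eq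
  by (intro dominated_integrable dominated_intros dominated_partials_2 dominated_tau)

lemma slice_integrable_weak_superenergy_tensor:
  "slice_integrable (weak_superenergy_tensor m \<phi> \<alpha> \<beta> \<mu> \<nu>) t"
  unfolding slice_integrable_def weak_superenergy_tensor_def d_up_eq dd_up_eq dd_mixed_eq
  by (intro dominated_integrable dominated_intros dominated_partials_1 dominated_partials_2)

lemma vanishing_flux_partials_mult:
  assumes "j \<in> {1, 2, 3}"
    and "rapidly_decreasing (\<lambda>x. partials p \<phi> (event t x))"
    and "rapidly_decreasing (\<lambda>x. partials q \<phi> (event t x))"
  shows "vanishing_flux t j (\<lambda>x. partials p \<phi> x * partials q \<phi> x)"
  by (intro vanishing_flux_mult smooth_partials sm assms)

lemma surface_term_superenergy_flux_eq_0: "surface_term (superenergy_flux m) \<phi> t = 0"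
  unfolding surface_term_def
proof (rule slice_integral_spatial_divergence_eq_0)
  fix j :: 4
  assume "j \<in> {1, 2, 3}"
  then show "vanishing_flux t j (superenergy_flux m j \<phi>)"
    unfolding superenergy_flux_def[abs_def]
    by (intro vanishing_flux_add vanishing_flux_sum vanishing_flux_scale
        vanishing_flux_partials_mult slice_rapidly_decreasing) auto
qed

text \<open>Every factor of the flux has at most one time derivative, taken first, so it decreases
  rapidly; for \<open>partials [0, i] \<phi>\<close> this uses that \<open>i\<close> is
  spatial.\<close>

lemma surface_term_supermomentum_flux_eq_0:
  assumes "i \<in> {1, 2, 3}"
  shows "surface_term (supermomentum_flux m i) \<phi> t = 0"
  unfolding surface_term_def
proof (rule slice_integral_spatial_divergence_eq_0)
  fix j :: 4
  assume "j \<in> {1, 2, 3}"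
  then show "vanishing_flux t j (supermomentum_flux m i j \<phi>)"
    unfolding supermomentum_flux_def[abs_def] using assms
    by (intro vanishing_flux_add vanishing_flux_sum vanishing_flux_scale
        vanishing_flux_partials_mult slice_rapidly_decreasing) auto
qed

end

text \<open>The fluxes are chosen before the field, hence depend on \<open>m\<close> and the indices
  alone. Outside the rapidly decreasing case the integrated identities are conditional on
  integrability of both densities.\<close>

theorem theorem6:
  fixes m :: real
  assumes "0 \<le> m"
  shows "\<exists>(V :: 4 \<Rightarrow> scalar_field \<Rightarrow> scalar_field) (Z :: 4 \<Rightarrow> 4 \<Rightarrow> scalar_field \<Rightarrow> scalar_field).
    (\<forall>j\<in>{1, 2, 3}. quadratic_expression (V j)) \<and>
    (\<forall>i\<in>{1, 2, 3}. \<forall>j\<in>{1, 2, 3}. quadratic_expression (Z i j)) \<and>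
    (\<forall>\<phi>. smooth \<phi> \<and> klein_gordon m \<phi> \<longrightarrow>
      (\<forall>x. superenergy_tensor m \<phi> 0 0 0 0 x
             = weak_superenergy_tensor m \<phi> 0 0 0 0 x + spatial_divergence (\<lambda>j. V j \<phi>) x) \<and>
      (\<forall>i\<in>{1, 2, 3}. \<forall>x. superenergy_tensor m \<phi> i 0 0 0 x
             = weak_superenergy_tensor m \<phi> i 0 0 0 x + spatial_divergence (\<lambda>j. Z i j \<phi>) x) \<and>
      (\<forall>t. slice_integrable (superenergy_tensor m \<phi> 0 0 0 0) t \<and>
           slice_integrable (weak_superenergy_tensor m \<phi> 0 0 0 0) t \<longrightarrow>
           slice_integrable (spatial_divergence (\<lambda>j. V j \<phi>)) t \<and>
           superenergy m \<phi> t = weak_superenergy m \<phi> t + surface_term V \<phi> t) \<and>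
      (\<forall>i\<in>{1, 2, 3}. \<forall>t. slice_integrable (superenergy_tensor m \<phi> i 0 0 0) t \<and>
           slice_integrable (weak_superenergy_tensor m \<phi> i 0 0 0) t \<longrightarrow>
           slice_integrable (spatial_divergence (\<lambda>j. Z i j \<phi>)) t \<and>
           supermomentum m \<phi> i t = weak_supermomentum m \<phi> i t + surface_term (Z i) \<phi> t) \<and>
      (\<forall>t. rapidly_decreasing (\<lambda>x. \<phi> (event t x)) \<and>
           rapidly_decreasing (\<lambda>x. partials [0] \<phi> (event t x)) \<longrightarrow>
           slice_integrable (superenergy_tensor m \<phi> 0 0 0 0) t \<and>
           slice_integrable (weak_superenergy_tensor m \<phi> 0 0 0 0) t \<and>
           surface_term V \<phi> t = 0 \<and>
           superenergy m \<phi> t = weak_superenergy m \<phi> t \<and>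
           (\<forall>i\<in>{1, 2, 3}.
              slice_integrable (superenergy_tensor m \<phi> i 0 0 0) t \<and>
              slice_integrable (weak_superenergy_tensor m \<phi> i 0 0 0) t \<and>
              surface_term (Z i) \<phi> t = 0 \<and>
              supermomentum m \<phi> i t = weak_supermomentum m \<phi> i t)))"
proof (intro exI[of _ "superenergy_flux m"] exI[of _ "supermomentum_flux m"] conjI ballI allI impI;
    (elim conjE)?)
  show "quadratic_expression (superenergy_flux m j)" for j
    by (rule quadratic_superenergy_flux)
  show "quadratic_expression (supermomentum_flux m i j)" for i j
    by (rule quadratic_supermomentum_flux)
  fix \<phi> :: scalar_field
  assume sol: "smooth \<phi>" "klein_gordon m \<phi>"
  note W = superenergy_eq_weak_plus_divergence[OF sol]
  note S = supermomentum_eq_weak_plus_divergence[OF sol]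
  show "superenergy_tensor m \<phi> 0 0 0 0 x
      = weak_superenergy_tensor m \<phi> 0 0 0 0 x + spatial_divergence (\<lambda>j. superenergy_flux m j \<phi>) x" for x
    by (rule W)
  show "superenergy_tensor m \<phi> i 0 0 0 x
      = weak_superenergy_tensor m \<phi> i 0 0 0 x + spatial_divergence (\<lambda>j. supermomentum_flux m i j \<phi>) x"
    if "i \<in> {1, 2, 3}" for i x
    by (rule S[OF that])
  fix t
  have energy: "slice_integrable (spatial_divergence (\<lambda>j. superenergy_flux m j \<phi>)) t"
    "superenergy m \<phi> t = weak_superenergy m \<phi> t + surface_term (superenergy_flux m) \<phi> t"
    if "slice_integrable (superenergy_tensor m \<phi> 0 0 0 0) t"
      "slice_integrable (weak_superenergy_tensor m \<phi> 0 0 0 0) t"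
    unfolding superenergy_def weak_superenergy_def surface_term_def
    by (rule slice_integral_split[OF W that])+
  have momentum: "slice_integrable (spatial_divergence (\<lambda>j. supermomentum_flux m i j \<phi>)) t"
    "supermomentum m \<phi> i t = weak_supermomentum m \<phi> i t + surface_term (supermomentum_flux m i) \<phi> t"
    if "i \<in> {1, 2, 3}" "slice_integrable (superenergy_tensor m \<phi> i 0 0 0) t"
      "slice_integrable (weak_superenergy_tensor m \<phi> i 0 0 0) t" for i
    unfolding supermomentum_def weak_supermomentum_def surface_term_def
    by (rule slice_integral_split[OF S[OF that(1)] that(2,3)])+
  show "slice_integrable (spatial_divergence (\<lambda>j. superenergy_flux m j \<phi>)) t"
    "superenergy m \<phi> t = weak_superenergy m \<phi> t + surface_term (superenergy_flux m) \<phi> t"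
    if "slice_integrable (superenergy_tensor m \<phi> 0 0 0 0) t"
      "slice_integrable (weak_superenergy_tensor m \<phi> 0 0 0 0) t"
    by (rule energy[OF that])+
  show "slice_integrable (spatial_divergence (\<lambda>j. supermomentum_flux m i j \<phi>)) t"
    "supermomentum m \<phi> i t = weak_supermomentum m \<phi> i t + surface_term (supermomentum_flux m i) \<phi> t"
    if "i \<in> {1, 2, 3}" "slice_integrable (superenergy_tensor m \<phi> i 0 0 0) t"
      "slice_integrable (weak_superenergy_tensor m \<phi> i 0 0 0) t" for i
    by (rule momentum[OF that])+
  assume rapid: "rapidly_decreasing (\<lambda>x. \<phi> (event t x))"
    "rapidly_decreasing (\<lambda>x. partials [0] \<phi> (event t x))"
  \<comment> \<open>The tensor indices stay free, so these facts serve both the energy and the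
    momentum densities.\<close>
  note int = slice_integrable_superenergy_tensor[OF sol rapid]
    slice_integrable_weak_superenergy_tensor[OF sol rapid]
  show "slice_integrable (superenergy_tensor m \<phi> 0 0 0 0) t"
    "slice_integrable (weak_superenergy_tensor m \<phi> 0 0 0 0) t"
    by (rule int)+
  show flux: "surface_term (superenergy_flux m) \<phi> t = 0"
    by (rule surface_term_superenergy_flux_eq_0[OF sol rapid])
  show "superenergy m \<phi> t = weak_superenergy m \<phi> t"
    using energy(2)[OF int] flux by simp
  fix i :: 4
  assume i: "i \<in> {1, 2, 3}"
  show "slice_integrable (superenergy_tensor m \<phi> i 0 0 0) t"
    "slice_integrable (weak_superenergy_tensor m \<phi> i 0 0 0) t"
    by (rule int)+
  show flux_i: "surface_term (supermomentum_flux m i) \<phi> t = 0"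
    by (rule surface_term_supermomentum_flux_eq_0[OF sol rapid i])
  show "supermomentum m \<phi> i t = weak_supermomentum m \<phi> i t"
    using momentum(2)[OF i int] flux_i by simp
qed

end
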